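(* Let $K$ and $K'$ be finite simplicial complexes with Alexandrov topologies $\mathcal{T}$ and $\mathcal{T}'$, let $F:K\multimap K$ and $F':K'\multimap K'$ be combinatorial dynamical systems, and let $\mathcal{M}$ and $\mathcal{M}'$ be Morse decompositions for $F$ and $F'$, respectively. Assume that a continuous map $f:(K,\mathcal{T})\to(K',\mathcal{T}')$ respects $\mathcal{M}$ and $\mathcal{M}'$, that is, for every $M\in\mathcal{M}$ there exists $M'\in\mathcal{M}'$ with $f(M)\subseteq M'$. Then the map $$f_{\mathcal{M},\mathcal{M}'}:(\langle\mathcal{M}\rangle,\mathcal{T}_{\mathcal{M}})\ni\sigma\mapsto f(\sigma)\in(\langle\mathcal{M}'\rangle,\mathcal{T}'_{\mathcal{M}'})$$ is well defined and continuous.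
   Context: A finite simplicial complex $K$ is regarded as the finite set of its simplices, partially ordered by the face relation ($\sigma\preceq\tau$ iff $\sigma$ is a face of $\tau$). Its Alexandrov topology is the $T_0$ topology on $K$ whose open sets are the upper sets for $\preceq$ (so a set is closed iff it contains all faces of its elements). A map $K\to K'$ is continuous iff it preserves the face relation. A combinatorial dynamical system on $K$ is a multivalued map $F:K\multimap K$, assigning to each $\sigma\in K$ a non-empty set $F(\sigma)\subseteq K$. A solution of $F$ in $A\subseteq K$ is a map $\rho:D\to A$, where $D=\mathbb{Z}$ (full solution) or $D=\mathbb{Z}\cap[m,n]$ (partial solution, with left endpoint $\rho(m)$ and right endpoint $\rho(n)$), such that $\rho(i+1)\in F(\rho(i))$ whenever $i,i+1\in D$. A set $A$ is invariant if each $\sigma\in A$ is a value of a full solution in $A$. An invariant set $S$ is isolated if there is a closed set $N\supseteq S$ such that every partial solution in $N$ with endpoints in $S$ has all values in $S$. The maximal invariant set $S(F)$ is the set of all values of full solutions in $K$. A connection from an isolated invariant set $S_1$ to an isolated invariant set $S_2$ is a partial solution with left endpoint in $S_1$ and right endpoint in $S_2$. A Morse decomposition for $F$ is a family $\mathcal{M}$ of mutually disjoint, non-empty isolated invariant subsets of $S(F)$ admitting a partial order $\leq$ such that any connection between elements of $\mathcal{M}$ either has all values in a single element of $\mathcal{M}$ or originates in some $M\in\mathcal{M}$ and terminates in some $M'\in\mathcal{M}$ with $M>M'$. For a finite family $\mathcal{A}$ of mutually disjoint non-empty subsets of a topological space $(X,\mathcal{T})$, $\langle\mathcal{A}\rangle:=\bigcup\mathcal{A}$,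 and $\mathcal{T}_{\mathcal{A}}$ is the topology on $\langle\mathcal{A}\rangle$ consisting of all unions of sets of the form $A\cap U$ with $A\in\mathcal{A}$, $U\in\mathcal{T}$. *)

theory Defs
  imports "HOL-Analysis.Analysis"
begin

section \<open>Finite simplicial complexes and the Alexandrov topology\<close>

text \<open>
  A complex is identified with its set of simplices, and a simplex with its finite non-empty
  vertex set. The face relation is then \<open>\<subseteq>\<close>. The empty set is not a simplex.
\<close>

definition finite_simplicial_complex :: "'a set set \<Rightarrow> bool" where
  "finite_simplicial_complex K \<longleftrightarrow>
     finite K \<and>
     (\<forall>\<sigma>\<in>K. finite \<sigma> \<and> \<sigma> \<noteq> {}) \<and>
     (\<forall>\<tau>\<in>K. \<forall>\<sigma>. \<sigma> \<subseteq> \<tau> \<and> \<sigma> \<noteq> {} \<longrightarrow> \<sigma> \<in> K)"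

definition alexandrov_topology :: "'a set set \<Rightarrow> 'a set topology" where
  "alexandrov_topology K =
     topology (\<lambda>U. U \<subseteq> K \<and> (\<forall>\<sigma>\<in>U. \<forall>\<tau>\<in>K. \<sigma> \<subseteq> \<tau> \<longrightarrow> \<tau> \<in> U))"

lemma openin_alexandrov_topology:
  "openin (alexandrov_topology K) U \<longleftrightarrow>
     U \<subseteq> K \<and> (\<forall>\<sigma>\<in>U. \<forall>\<tau>\<in>K. \<sigma> \<subseteq> \<tau> \<longrightarrow> \<tau> \<in> U)"
proof -
  have "istopology (\<lambda>U. U \<subseteq> K \<and> (\<forall>\<sigma>\<in>U. \<forall>\<tau>\<in>K. \<sigma> \<subseteq> \<tau> \<longrightarrow> \<tau> \<in> U))"
    unfolding istopology_def by blast
  then show ?thesis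
    unfolding alexandrov_topology_def by simp
qed

lemma topspace_alexandrov_topology [simp]: "topspace (alexandrov_topology K) = K"
proof
  show "topspace (alexandrov_topology K) \<subseteq> K"
    using openin_topspace[of "alexandrov_topology K"]
    unfolding openin_alexandrov_topology by blast
  show "K \<subseteq> topspace (alexandrov_topology K)"
    by (intro openin_subset) (simp add: openin_alexandrov_topology)
qed

lemma closedin_alexandrov_topology:
  "closedin (alexandrov_topology K) N \<longleftrightarrow>
     N \<subseteq> K \<and> (\<forall>\<tau>\<in>N. \<forall>\<sigma>\<in>K. \<sigma> \<subseteq> \<tau> \<longrightarrow> \<sigma> \<in> N)"
  unfolding closedin_def by (auto simp: openin_alexandrov_topology)


section \<open>Combinatorial dynamical systems and Morse decompositions\<close>

definition combinatorial_dynamical_system :: "'a set set \<Rightarrow> ('a set \<Rightarrow> 'a set set) \<Rightarrow> bool" where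
  "combinatorial_dynamical_system K F \<longleftrightarrow> (\<forall>\<sigma>\<in>K. F \<sigma> \<noteq> {} \<and> F \<sigma> \<subseteq> K)"

text \<open>
  The only domains \<open>D\<close> considered are \<open>UNIV\<close> (full solutions) and non-empty intervals \<open>{m..n}\<close>
  (partial solutions). Values of \<open>\<rho>\<close> outside \<open>D\<close> are irrelevant.
\<close>

definition solution_on ::
  "('a set \<Rightarrow> 'a set set) \<Rightarrow> 'a set set \<Rightarrow> int set \<Rightarrow> (int \<Rightarrow> 'a set) \<Rightarrow> bool" where
  "solution_on F A D \<rho> \<longleftrightarrow>
     \<rho> ` D \<subseteq> A \<and> (\<forall>i. i \<in> D \<and> i + 1 \<in> D \<longrightarrow> \<rho> (i + 1) \<in> F (\<rho> i))"

definition full_solution ::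
  "('a set \<Rightarrow> 'a set set) \<Rightarrow> 'a set set \<Rightarrow> (int \<Rightarrow> 'a set) \<Rightarrow> bool" where
  "full_solution F A \<rho> \<longleftrightarrow> solution_on F A UNIV \<rho>"

definition partial_solution ::
  "('a set \<Rightarrow> 'a set set) \<Rightarrow> 'a set set \<Rightarrow> int \<Rightarrow> int \<Rightarrow> (int \<Rightarrow> 'a set) \<Rightarrow> bool" where
  "partial_solution F A m n \<rho> \<longleftrightarrow> m \<le> n \<and> solution_on F A {m..n} \<rho>"

definition invariant_set :: "('a set \<Rightarrow> 'a set set) \<Rightarrow> 'a set set \<Rightarrow> bool" where
  "invariant_set F A \<longleftrightarrow> (\<forall>\<sigma>\<in>A. \<exists>\<rho>. full_solution F A \<rho> \<and> \<sigma> \<in> range \<rho>)"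

definition isolated_invariant_set ::
  "'a set set \<Rightarrow> ('a set \<Rightarrow> 'a set set) \<Rightarrow> 'a set set \<Rightarrow> bool" where
  "isolated_invariant_set K F S \<longleftrightarrow>
     S \<subseteq> K \<and> invariant_set F S \<and>
     (\<exists>N. closedin (alexandrov_topology K) N \<and> S \<subseteq> N \<and>
        (\<forall>\<rho> m n. partial_solution F N m n \<rho> \<and> \<rho> m \<in> S \<and> \<rho> n \<in> S \<longrightarrow> \<rho> ` {m..n} \<subseteq> S))"

definition maximal_invariant_set ::
  "'a set set \<Rightarrow> ('a set \<Rightarrow> 'a set set) \<Rightarrow> 'a set set" where
  "maximal_invariant_set K F = {\<sigma>. \<exists>\<rho>. full_solution F K \<rho> \<and> \<sigma> \<in> range \<rho>}"

definition connection ::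
  "'a set set \<Rightarrow> ('a set \<Rightarrow> 'a set set) \<Rightarrow> 'a set set \<Rightarrow> 'a set set \<Rightarrow>
   int \<Rightarrow> int \<Rightarrow> (int \<Rightarrow> 'a set) \<Rightarrow> bool" where
  "connection K F S\<^sub>1 S\<^sub>2 m n \<rho> \<longleftrightarrow>
     isolated_invariant_set K F S\<^sub>1 \<and> isolated_invariant_set K F S\<^sub>2 \<and>
     partial_solution F K m n \<rho> \<and> \<rho> m \<in> S\<^sub>1 \<and> \<rho> n \<in> S\<^sub>2"

text \<open>In the definition below, \<open>(M', M) \<in> r\<close> encodes \<open>M' \<le> M\<close>.\<close>

definition morse_decomposition ::
  "'a set set \<Rightarrow> ('a set \<Rightarrow> 'a set set) \<Rightarrow> 'a set set set \<Rightarrow> bool" where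
  "morse_decomposition K F \<M> \<longleftrightarrow>
     disjoint \<M> \<and>
     (\<forall>M\<in>\<M>. M \<noteq> {} \<and> isolated_invariant_set K F M \<and> M \<subseteq> maximal_invariant_set K F) \<and>
     (\<exists>r. partial_order_on \<M> r \<and>
        (\<forall>M\<^sub>1\<in>\<M>. \<forall>M\<^sub>2\<in>\<M>. \<forall>m n \<rho>. connection K F M\<^sub>1 M\<^sub>2 m n \<rho> \<longrightarrow>
           (\<exists>M\<in>\<M>. \<rho> ` {m..n} \<subseteq> M) \<or>
           (\<exists>M\<in>\<M>. \<exists>M'\<in>\<M>. \<rho> m \<in> M \<and> \<rho> n \<in> M' \<and> (M', M) \<in> r \<and> M' \<noteq> M)))"

definition respects_families :: "('a \<Rightarrow> 'b) \<Rightarrow> 'a set set \<Rightarrow> 'b set set \<Rightarrow> bool" where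
  "respects_families f \<M> \<M>' \<longleftrightarrow> (\<forall>M\<in>\<M>. \<exists>M'\<in>\<M>'. f ` M \<subseteq> M')"


section \<open>The topology induced by a disjoint family\<close>

text \<open>
  Disjointness of \<open>\<A>\<close> is what makes the unions of the sets \<open>A \<inter> U\<close> a topology, and
  \<^const>\<open>topology\<close> is unspecified on predicates that are not topologies. Accordingly the
  lemma \<open>openin_family_topology\<close> assumes disjointness.
\<close>

definition family_topology :: "'a topology \<Rightarrow> 'a set set \<Rightarrow> 'a topology" where
  "family_topology X \<A> =
     topology (\<lambda>W. \<exists>\<C>. \<C> \<subseteq> {A \<inter> U |A U. A \<in> \<A> \<and> openin X U} \<and> W = \<Union>\<C>)"

lemma openin_family_topology:
  assumes "disjoint \<A>"
  shows "openin (family_topology X \<A>) W \<longleftrightarrow>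
           (\<exists>\<C>. \<C> \<subseteq> {A \<inter> U |A U. A \<in> \<A> \<and> openin X U} \<and> W = \<Union>\<C>)"
proof -
  define B where "B = {A \<inter> U |A U. A \<in> \<A> \<and> openin X U}"
  have base: "C \<inter> D = {} \<or> C \<inter> D \<in> B" if CB: "C \<in> B" and DB: "D \<in> B" for C D
  proof -
    obtain A U where C: "C = A \<inter> U" "A \<in> \<A>" "openin X U"
      using CB unfolding B_def by blast
    obtain A' V where D: "D = A' \<inter> V" "A' \<in> \<A>" "openin X V"
      using DB unfolding B_def by blast
    show ?thesis
    proof (cases "A = A'")
      case True
      then have "C \<inter> D = A \<inter> (U \<inter> V)" by (simp add: C(1) D(1) Int_ac)
      moreover have "openin X (U \<inter> V)" using C(3) D(3) by (rule openin_Int)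
      ultimately show ?thesis unfolding B_def using C(2) by (intro disjI2 CollectI exI conjI)
    next
      case False
      then have "A \<inter> A' = {}" using disjointD[OF assms C(2) D(2)] by simp
      then have "C \<inter> D = {}" unfolding C(1) D(1) by blast
      then show ?thesis by (rule disjI1)
    qed
  qed
  define P where "P = (\<lambda>W. \<exists>\<C>. \<C> \<subseteq> B \<and> W = \<Union>\<C>)"
  have P_iff: "P W \<longleftrightarrow> (\<forall>x\<in>W. \<exists>C\<in>B. x \<in> C \<and> C \<subseteq> W)" for W
  proof
    assume "P W"
    then obtain \<C> where "\<C> \<subseteq> B" "W = \<Union>\<C>" unfolding P_def by blast
    then show "\<forall>x\<in>W. \<exists>C\<in>B. x \<in> C \<and> C \<subseteq> W" by blast
  next
    assume "\<forall>x\<in>W. \<exists>C\<in>B. x \<in> C \<and> C \<subseteq> W"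
    then have "W = \<Union>{C \<in> B. C \<subseteq> W}" by (intro equalityI subsetI) (fast, simp, fast)
    then show "P W" unfolding P_def by (intro exI[of _ "{C \<in> B. C \<subseteq> W}"]) simp
  qed
  have inter: "P (S \<inter> T)" if S: "P S" and T: "P T" for S T
    unfolding P_iff
  proof
    fix x assume x: "x \<in> S \<inter> T"
    obtain C where C: "C \<in> B" "x \<in> C" "C \<subseteq> S" using S x unfolding P_iff by blast
    obtain D where D: "D \<in> B" "x \<in> D" "D \<subseteq> T" using T x unfolding P_iff by blast
    have "C \<inter> D \<in> B" using base[OF C(1) D(1)] C(2) D(2) by blast
    then show "\<exists>C\<in>B. x \<in> C \<and> C \<subseteq> S \<inter> T" using C D by blast
  qed
  have union: "P (\<Union>\<K>)" if "\<forall>W\<in>\<K>. P W" for \<K>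
    unfolding P_iff
  proof
    fix x assume "x \<in> \<Union>\<K>"
    then obtain W where W: "W \<in> \<K>" "x \<in> W" by blast
    then have "P W" using that by blast
    then obtain C where "C \<in> B" "x \<in> C" "C \<subseteq> W" using W(2) unfolding P_iff by blast
    then show "\<exists>C\<in>B. x \<in> C \<and> C \<subseteq> \<Union>\<K>" using W(1) by blast
  qed
  have "istopology P"
    unfolding istopology_def by (intro conjI allI impI inter union)
  then have "openin (topology P) = P"
    by (rule topology_inverse')
  then have "openin (topology P) W = P W"
    by (rule fun_cong)
  then show ?thesis
    unfolding family_topology_def B_def P_def .
qed

lemma topspace_family_topology:
  assumes "disjoint \<A>" and "\<Union>\<A> \<subseteq> topspace X"
  shows "topspace (family_topology X \<A>) = \<Union>\<A>"
proof
  show "topspace (family_topology X \<A>) \<subseteq> \<Union>\<A>"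
  proof -
    obtain \<C> where C: "\<C> \<subseteq> {A \<inter> U |A U. A \<in> \<A> \<and> openin X U}"
      and top: "topspace (family_topology X \<A>) = \<Union>\<C>"
      using openin_topspace[of "family_topology X \<A>", unfolded openin_family_topology[OF assms(1)]]
      by (elim exE conjE)
    have "\<Union>\<C> \<subseteq> \<Union>\<A>"
    proof (rule Union_least)
      fix D assume "D \<in> \<C>"
      then have "D \<in> {A \<inter> U |A U. A \<in> \<A> \<and> openin X U}" using C by (rule rev_subsetD)
      then obtain A U where "D = A \<inter> U" "A \<in> \<A>" by (elim CollectE exE conjE)
      then show "D \<subseteq> \<Union>\<A>" by blast
    qed
    then show ?thesis by (simp only: top)
  qed
  have "A \<in> {A \<inter> U |A U. A \<in> \<A> \<and> openin X U}" if "A \<in> \<A>" for A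
  proof -
    have "A = A \<inter> topspace X" using that assms(2) by blast
    then show ?thesis
      by (intro CollectI exI[of _ A] exI[of _ "topspace X"] conjI that openin_topspace)
  qed
  then have "\<A> \<subseteq> {A \<inter> U |A U. A \<in> \<A> \<and> openin X U}"
    by (rule subsetI)
  then have "openin (family_topology X \<A>) (\<Union>\<A>)"
    unfolding openin_family_topology[OF assms(1)] by (intro exI[of _ \<A>] conjI refl)
  then show "\<Union>\<A> \<subseteq> topspace (family_topology X \<A>)"
    by (rule openin_subset)
qed

end

theory Submission
  imports Defs
begin

text \<open>
  A Morse decomposition is in particular a disjoint family of subsets of the complex, and the
  claim is an instance of the fact that a continuous map of topological spaces remains continuous
  when both spaces are re-topologised along disjoint families that it respects.

  The topology of a disjoint family makes every member \<open>A\<close> open and induces on it the subspace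
  topology, so the space is the topological sum of its members. A map that respects the families
  sends each summand into a single summand, and on each summand it is a restriction of a continuous
  map; hence it is continuous. Concretely, if \<open>x \<in> A\<close> and \<open>f ` A \<subseteq> B\<close>, then disjointness
  forces every basic neighbourhood of \<open>f x\<close> to have the form \<open>B \<inter> V\<close>, and \<open>A \<inter> f -` V\<close> is a
  neighbourhood of \<open>x\<close> that \<open>f\<close> maps into it.
\<close>

lemma openin_family_topology_local:
  assumes "disjoint \<A>"
  shows "openin (family_topology X \<A>) W \<longleftrightarrow>
           (\<forall>x\<in>W. \<exists>A\<in>\<A>. \<exists>U. openin X U \<and> x \<in> A \<inter> U \<and> A \<inter> U \<subseteq> W)"
  (is "_ \<longleftrightarrow> ?local")
proof
  assume "openin (family_topology X \<A>) W"
  then obtain \<C> where \<C>: "\<C> \<subseteq> {A \<inter> U |A U. A \<in> \<A> \<and> openin X U}" and W: "W = \<Union>\<C>"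
    unfolding openin_family_topology[OF assms] by (elim exE conjE)
  show ?local
  proof
    fix x assume "x \<in> W"
    then obtain C where C: "C \<in> \<C>" "x \<in> C"
      unfolding W by (rule UnionE)
    have "C \<in> {A \<inter> U |A U. A \<in> \<A> \<and> openin X U}"
      using \<C> C(1) by (rule subsetD)
    then obtain A U where AU: "C = A \<inter> U" "A \<in> \<A>" "openin X U"
      by (elim CollectE exE conjE)
    moreover have "C \<subseteq> W"
      unfolding W using C(1) by (rule Union_upper)
    ultimately show "\<exists>A\<in>\<A>. \<exists>U. openin X U \<and> x \<in> A \<inter> U \<and> A \<inter> U \<subseteq> W"
      using C(2) by (intro bexI[of _ A] exI[of _ U]) simp_all
  qed
next
  assume local: ?local
  define \<C> where "\<C> = {A \<inter> U |A U. A \<in> \<A> \<and> openin X U \<and> A \<inter> U \<subseteq> W}"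
  have "\<C> \<subseteq> {A \<inter> U |A U. A \<in> \<A> \<and> openin X U}"
    unfolding \<C>_def by fast
  moreover have "W = \<Union>\<C>"
  proof
    show "W \<subseteq> \<Union>\<C>"
    proof
      fix x assume "x \<in> W"
      then obtain A U where "A \<in> \<A>" "openin X U" "A \<inter> U \<subseteq> W" and x: "x \<in> A \<inter> U"
        using local by meson
      then have "A \<inter> U \<in> \<C>"
        unfolding \<C>_def by auto
      then show "x \<in> \<Union>\<C>"
        using x by (rule UnionI)
    qed
    show "\<Union>\<C> \<subseteq> W"
      unfolding \<C>_def by fast
  qed
  ultimately show "openin (family_topology X \<A>) W"
    unfolding openin_family_topology[OF assms] by (intro exI conjI)
qed

text \<open>
  Continuity of \<open>f\<close> alone is not enough: the members of \<open>\<B>\<close> are open in the new topology of the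
  target, and \<open>f\<close> could cut a member of \<open>\<A>\<close> into their preimages, which need not be relatively open.
\<close>

lemma continuous_map_family_topology:
  assumes "disjoint \<A>" and "\<Union>\<A> \<subseteq> topspace X"
    and "disjoint \<B>" and "\<Union>\<B> \<subseteq> topspace Y"
    and cont: "continuous_map X Y f"
    and resp: "respects_families f \<A> \<B>"
  shows "continuous_map (family_topology X \<A>) (family_topology Y \<B>) f"
  unfolding continuous_map_def topspace_family_topology[OF assms(1,2)]
    topspace_family_topology[OF assms(3,4)]
proof (intro conjI allI impI)
  show "f \<in> \<Union>\<A> \<rightarrow> \<Union>\<B>"
    using resp unfolding respects_families_def by blast
next
  fix W assume W: "openin (family_topology Y \<B>) W"
  show "openin (family_topology X \<A>) {x \<in> \<Union>\<A>. f x \<in> W}"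
    unfolding openin_family_topology_local[OF assms(1)]
  proof
    fix x assume "x \<in> {x \<in> \<Union>\<A>. f x \<in> W}"
    then obtain A where A: "A \<in> \<A>" "x \<in> A" and "f x \<in> W" by blast
    then obtain B V where BV: "B \<in> \<B>" "openin Y V" "f x \<in> B \<inter> V" "B \<inter> V \<subseteq> W"
      using W unfolding openin_family_topology_local[OF assms(3)] by blast
    obtain B' where B': "B' \<in> \<B>" "f ` A \<subseteq> B'"
      using resp A(1) unfolding respects_families_def by blast
    have "B' = B"
      using disjointD[OF assms(3) B'(1) BV(1)] B'(2) BV(3) A(2) by blast
    define U where "U = {y \<in> topspace X. f y \<in> V}"
    have "openin X U"
      unfolding U_def using cont BV(2) by (rule openin_continuous_map_preimage)
    moreover have "x \<in> A \<inter> U"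
      using A BV(3) assms(2) unfolding U_def by blast
    moreover have "A \<inter> U \<subseteq> {x \<in> \<Union>\<A>. f x \<in> W}"
      using A(1) B'(2) BV(4) unfolding U_def \<open>B' = B\<close> by blast
    ultimately show "\<exists>A\<in>\<A>. \<exists>U. openin X U \<and> x \<in> A \<inter> U \<and> A \<inter> U \<subseteq> {x \<in> \<Union>\<A>. f x \<in> W}"
      using A(1) by blast
  qed
qed

lemma morse_decomposition_disjoint: "morse_decomposition K F \<M> \<Longrightarrow> disjoint \<M>"
  unfolding morse_decomposition_def by (elim conjE)

lemma morse_decomposition_Union_subset:
  assumes "morse_decomposition K F \<M>"
  shows "\<Union>\<M> \<subseteq> K"
proof (rule Union_least)
  fix M assume "M \<in> \<M>"
  then have "isolated_invariant_set K F M"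
    using assms unfolding morse_decomposition_def by simp
  then show "M \<subseteq> K"
    unfolding isolated_invariant_set_def by (elim conjE)
qed

theorem theorem5p2:
  fixes K :: "'a set set" and K' :: "'b set set"
    and F :: "'a set \<Rightarrow> 'a set set" and F' :: "'b set \<Rightarrow> 'b set set"
    and \<M> :: "'a set set set" and \<M>' :: "'b set set set"
    and f :: "'a set \<Rightarrow> 'b set"
  assumes "finite_simplicial_complex K" and "finite_simplicial_complex K'"
    and "combinatorial_dynamical_system K F" and "combinatorial_dynamical_system K' F'"
    and "morse_decomposition K F \<M>" and "morse_decomposition K' F' \<M>'"
    and "continuous_map (alexandrov_topology K) (alexandrov_topology K') f"
    and "respects_families f \<M> \<M>'"
  shows "f ` \<Union>\<M> \<subseteq> \<Union>\<M>' \<and>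
    continuous_map (family_topology (alexandrov_topology K) \<M>)
                   (family_topology (alexandrov_topology K') \<M>') f"
proof
  show "f ` \<Union>\<M> \<subseteq> \<Union>\<M>'"
    using assms(8) unfolding respects_families_def by blast
  show "continuous_map (family_topology (alexandrov_topology K) \<M>)
                       (family_topology (alexandrov_topology K') \<M>') f"
    using assms(5-8)
    by (intro continuous_map_family_topology)
      (simp_all add: morse_decomposition_disjoint morse_decomposition_Union_subset)
qed

end
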